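(* Let $\mathcal{K}$ be a finite chain complex of cells over $\mathbb{Z}_2$ with a filtering function $g:\mathcal{K}\to\mathbb{Z}$ and sub-level complexes $\mathcal{K}_n=\{c\in\mathcal{K}: g(c)\le n\}$. Let $(A,b)\in\mathcal{K}\times\mathcal{K}$ be an elementary collapse pair in $\mathcal{K}$ (that is, $A$ is the unique coface of $b$ in $\mathcal{K}$), and suppose that for every $n\in\mathbb{Z}$ with $b\in\mathcal{K}_n$ the cell $b$ is a free face in $\mathcal{K}_n$. Suppose moreover that $g(A)=g(b)$. Then $\mathcal{K}$ and $\mathcal{K}\setminus\{A,b\}$ (with $g$ restricted to it) have the same persistent homology in every dimension.
   Context: Chain complexes. A (finite) chain complex of cells $\mathcal{K}$ over $\mathbb{Z}_2$ is a finite set of abstract cells, each with a dimension $p\ge 0$. Let $C_p(\mathcal{K})$ be the $\mathbb{Z}_2$-vector space with basis the $p$-cells of $\mathcal{K}$. There are linear boundary operators $\partial_p:C_p(\mathcal{K})\to C_{p-1}(\mathcal{K})$ (with $\partial_0=0$) satisfying $\partial_p\circ\partial_{p+1}=0$. Homology is $H_p(\mathcal{K})=\ker\partial_p/\operatorname{im}\partial_{p+1}$. A $(p-1)$-cell $a$ is a face of a $p$-cell $B$, and $B$ is a coface of $a$, if $a$ appears with nonzero coefficient in $\partial B$. Free faces. In a chain complex of cells, a cell $b$ is a free face if it has exactly one coface $A$; then $(A,b)$ is called an elementary collapse pair. Filtrations. A filtering function is a map $g:\mathcal{K}\to\mathbb{Z}$ with $g(a)\le g(B)$ whenever $a$ is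 a face of $B$. Then each $\mathcal{K}_t=\{c\in\mathcal{K}:g(c)\le t\}$ is a chain complex of cells (the boundary of each of its cells lies in it), with boundary operator restricted from $\mathcal{K}$. Removal of cells. $\mathcal{K}\setminus\{A,b\}$ is the set of cells obtained by deleting $A$ and $b$, with boundary operator obtained from that of $\mathcal{K}$ by deleting all terms involving the removed cells. It is filtered by the restriction of $g$. Persistence. For a filtered complex $X$ and integers $i\le j$, the $p$-th persistent homology groups are the images $\operatorname{im}\big(H_p(X_i)\to H_p(X_j)\big)$ of the maps induced by inclusion $X_i\hookrightarrow X_j$. The persistence of $X$ in dimension $p$ is represented by the multiset of persistence intervals (birth, death), i.e. the intervals of the decomposition of the sequence of vector spaces $\cdots\to H_p(X_i)\to H_p(X_{i+1})\to\cdots$ into interval modules; zero-length intervals are disregarded. Two filtered complexes have the same persistent homology in dimension $p$ if these multisets of intervals coincide. *)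

theory Defs
  imports
    "HOL-Algebra.Coset"
    "HOL-Library.Extended"
    "HOL-Library.Multiset"
    "HOL-Library.Poly_Mapping"
    "HOL-Library.Z2"
begin

section \<open>Vector spaces over the field with two elements\<close>

text \<open>
  A vector space over \<open>bit\<close> (the field with two elements) is an abelian group in which every
  element is its own inverse, and the linear maps are exactly the group homomorphisms. Vector
  spaces, quotients, images and isomorphisms are therefore those of \<open>HOL-Algebra\<close> groups.
\<close>

definition free_Z2_space :: "'a set \<Rightarrow> ('a \<Rightarrow>\<^sub>0 bit) monoid" where
  "free_Z2_space S =
     \<lparr>carrier = {c. Poly_Mapping.keys c \<subseteq> S}, monoid.mult = (+), one = 0\<rparr>"

definition restrict_chain :: "'a set \<Rightarrow> ('a \<Rightarrow>\<^sub>0 bit) \<Rightarrow> ('a \<Rightarrow>\<^sub>0 bit)" where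
  "restrict_chain S c =
     (\<Sum>x \<in> Poly_Mapping.keys c \<inter> S. Poly_Mapping.single x (Poly_Mapping.lookup c x))"


section \<open>Chain complexes of cells\<close>

text \<open>\<open>bd X B\<close> is the boundary of the basis vector given by the single cell \<open>B\<close>.\<close>

record 'a cell_complex =
  cells :: "'a set"
  cell_dim :: "'a \<Rightarrow> nat"
  bd :: "'a \<Rightarrow> ('a \<Rightarrow>\<^sub>0 bit)"

definition chain_space :: "'a cell_complex \<Rightarrow> nat \<Rightarrow> ('a \<Rightarrow>\<^sub>0 bit) monoid" where
  "chain_space X p = free_Z2_space {x \<in> cells X. cell_dim X x = p}"

text \<open>
  The linear extension of \<open>bd\<close>: a nonzero coefficient in \<open>bit\<close> is 1, so a chain is the sum of
  the cells in its support.
\<close>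

definition boundary :: "'a cell_complex \<Rightarrow> ('a \<Rightarrow>\<^sub>0 bit) \<Rightarrow> ('a \<Rightarrow>\<^sub>0 bit)" where
  "boundary X c = (\<Sum>x \<in> Poly_Mapping.keys c. bd X x)"

text \<open>
  The second condition says that the boundary operator lowers dimension by one; in particular
  it vanishes on 0-cells, as no cell \<open>a\<close> satisfies \<open>cell_dim X a + 1 = 0\<close>.
\<close>

definition chain_complex :: "'a cell_complex \<Rightarrow> bool" where
  "chain_complex X \<longleftrightarrow>
     finite (cells X) \<and>
     (\<forall>B \<in> cells X. Poly_Mapping.keys (bd X B) \<subseteq> {a \<in> cells X. cell_dim X a + 1 = cell_dim X B}) \<and>
     (\<forall>p. \<forall>c \<in> carrier (chain_space X (p + 1)). boundary X (boundary X c) = 0)"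

definition cycles :: "'a cell_complex \<Rightarrow> nat \<Rightarrow> ('a \<Rightarrow>\<^sub>0 bit) set" where
  "cycles X p = {c \<in> carrier (chain_space X p). boundary X c = 0}"

definition boundaries :: "'a cell_complex \<Rightarrow> nat \<Rightarrow> ('a \<Rightarrow>\<^sub>0 bit) set" where
  "boundaries X p = boundary X ` carrier (chain_space X (p + 1))"

definition homology :: "'a cell_complex \<Rightarrow> nat \<Rightarrow> ('a \<Rightarrow>\<^sub>0 bit) set monoid" where
  "homology X p = (chain_space X p)\<lparr>carrier := cycles X p\<rparr> Mod boundaries X p"

text \<open>
  For a subcomplex \<open>X\<close> of \<open>Y\<close>, the map on homology induced by the inclusion: it sends the coset
  \<open>z + boundaries X p\<close> to the coset \<open>z + boundaries Y p\<close>, which is its sum with \<open>boundaries Y p\<close>.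
\<close>

definition homology_inclusion ::
  "'a cell_complex \<Rightarrow> 'a cell_complex \<Rightarrow> nat \<Rightarrow> ('a \<Rightarrow>\<^sub>0 bit) set \<Rightarrow> ('a \<Rightarrow>\<^sub>0 bit) set" where
  "homology_inclusion X Y p C = boundaries Y p <#>\<^bsub>chain_space Y p\<^esub> C"

definition is_face :: "'a cell_complex \<Rightarrow> 'a \<Rightarrow> 'a \<Rightarrow> bool" where
  "is_face X a B \<longleftrightarrow>
     a \<in> cells X \<and> B \<in> cells X \<and> Poly_Mapping.lookup (bd X B) a \<noteq> 0"

definition free_face :: "'a cell_complex \<Rightarrow> 'a \<Rightarrow> bool" where
  "free_face X b \<longleftrightarrow> b \<in> cells X \<and> (\<exists>!A. is_face X b A)"

definition elementary_collapse_pair :: "'a cell_complex \<Rightarrow> 'a \<Rightarrow> 'a \<Rightarrow> bool" where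
  "elementary_collapse_pair X A b \<longleftrightarrow> free_face X b \<and> is_face X b A"

definition remove_cells :: "'a cell_complex \<Rightarrow> 'a set \<Rightarrow> 'a cell_complex" where
  "remove_cells X R =
     X\<lparr>cells := cells X - R, bd := (\<lambda>B. restrict_chain (cells X - R) (bd X B))\<rparr>"


section \<open>Filtrations and persistence\<close>

definition filtering_function :: "'a cell_complex \<Rightarrow> ('a \<Rightarrow> int) \<Rightarrow> bool" where
  "filtering_function X g \<longleftrightarrow> (\<forall>a B. is_face X a B \<longrightarrow> g a \<le> g B)"

definition sublevel :: "'a cell_complex \<Rightarrow> ('a \<Rightarrow> int) \<Rightarrow> int \<Rightarrow> 'a cell_complex" where
  "sublevel X g n = X\<lparr>cells := {c \<in> cells X. g c \<le> n}\<rparr>"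

text \<open>
  An interval \<open>(birth, death)\<close> is alive at the integers \<open>t\<close> with \<open>birth \<le> t < death\<close>; the death
  is \<open>\<infinity>\<close> for classes that never die. Zero-length intervals are excluded by \<open>birth < death\<close>.
\<close>

type_synonym interval = "int \<times> int extended"

definition alive :: "interval list \<Rightarrow> int \<Rightarrow> nat set" where
  "alive ivs t = {k. k < length ivs \<and> fst (ivs ! k) \<le> t \<and> Fin t < snd (ivs ! k)}"

text \<open>
  The interval module of an interval \<open>I\<close> is one-dimensional at the integers where \<open>I\<close> is alive
  and zero elsewhere, with identity maps wherever source and target are both one-dimensional.
  The direct sum of the interval modules of a list of intervals is thus, at \<open>t\<close>, the space
  \<open>free_Z2_space (alive ivs t)\<close>, and its structure map from \<open>s\<close> to \<open>t\<close> (for \<open>s \<le> t\<close>) is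
  \<open>restrict_chain (alive ivs t)\<close>.

  \<open>interval_decomposition V f J\<close> says that the persistence module with spaces \<open>V t\<close> and
  structure maps \<open>f s t\<close> is isomorphic to the direct sum of the interval modules of \<open>J\<close>.
\<close>

definition interval_decomposition ::
  "(int \<Rightarrow> 'v monoid) \<Rightarrow> (int \<Rightarrow> int \<Rightarrow> 'v \<Rightarrow> 'v) \<Rightarrow> interval multiset \<Rightarrow> bool" where
  "interval_decomposition V f J \<longleftrightarrow>
     (\<forall>(birth, death) \<in># J. Fin birth < death) \<and>
     (\<exists>ivs \<phi>. mset ivs = J \<and>
        (\<forall>t. \<phi> t \<in> iso (free_Z2_space (alive ivs t)) (V t)) \<and>
        (\<forall>s t. s \<le> t \<longrightarrow> (\<forall>c \<in> carrier (free_Z2_space (alive ivs s)).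
           \<phi> t (restrict_chain (alive ivs t) c) = f s t (\<phi> s c))))"

text \<open>
  The multiset of persistence intervals in dimension \<open>p\<close>. For a finite filtered complex the
  interval decomposition exists and its multiset of intervals is unique.
\<close>

definition persistence_intervals ::
  "'a cell_complex \<Rightarrow> ('a \<Rightarrow> int) \<Rightarrow> nat \<Rightarrow> interval multiset" where
  "persistence_intervals X g p =
     (THE J. interval_decomposition
        (\<lambda>t. homology (sublevel X g t) p)
        (\<lambda>s t. homology_inclusion (sublevel X g s) (sublevel X g t) p) J)"

definition same_persistent_homology ::
  "'a cell_complex \<Rightarrow> ('a \<Rightarrow> int) \<Rightarrow> 'a cell_complex \<Rightarrow> ('a \<Rightarrow> int) \<Rightarrow> nat \<Rightarrow> bool" where
  "same_persistent_homology X g Y h p \<longleftrightarrow>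
     persistence_intervals X g p = persistence_intervals Y h p"

end

theory Submission
  imports Defs "HOL-Algebra.SndIsomorphismGrp"
begin

text \<open>
  Since \<open>A\<close> is the only coface of \<open>b\<close>, the coefficient of \<open>b\<close> in \<open>\<partial>c\<close> is that of \<open>A\<close> in \<open>c\<close>.
  Applied to \<open>\<partial>\<partial>B = 0\<close> this shows that \<open>A\<close> has no coface, so deleting \<open>A\<close> and \<open>b\<close> leaves a
  subcomplex with unchanged boundary operator. A cycle cannot contain \<open>A\<close>, and adding \<open>\<partial>A\<close> removes
  \<open>b\<close> from it; a chain bounding a cycle of the subcomplex is corrected in the same way. Hence the
  inclusion induces an isomorphism on homology. As \<open>g A = g b\<close>, this applies to every sublevel
  complex containing \<open>b\<close>, while the others are unaffected, so the inclusions form an isomorphism of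
  persistence modules. Isomorphic modules have the same interval decompositions; neither existence
  nor uniqueness of a decomposition is involved.
\<close>

section \<open>Isomorphisms of quotients and persistence modules\<close>

context second_isomorphism_grp
begin

text \<open>Absorbing \<open>M\<close> into \<open>H\<close> gives \<open>H <#> M = H\<close>, and
  associativity does the rest. With \<open>H\<close> and \<open>M\<close> the boundaries of a
  complex and of a subcomplex, this evaluates the induced map on homology at a coset.\<close>

lemma set_mult_rcoset_absorb:
  assumes "M \<subseteq> H" "\<one> \<in> M" "x \<in> carrier G"
  shows "H <#> (M #> x) = H #> x"
proof -
  have "H <#> M = H"
    using assms subset by (force simp: set_mult_def)
  then show ?thesis
    using assms subset by (simp add: setmult_rcos_assoc)
qed

text \<open>The second isomorphism theorem, with its map rewritten from \<open>the_elem\<close> of a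
  set of cosets to \<open>H <#> C\<close>, the shape of \<open>homology_inclusion\<close>.\<close>

lemma normal_intersection_set_mult_iso:
  "(\<lambda>C. H <#> C) \<in> iso (G\<lparr>carrier := S\<rparr> Mod (H \<inter> S)) (G\<lparr>carrier := H <#> S\<rparr> Mod H)"
    (is "_ \<in> iso ?Q ?R")
proof -
  have eq: "the_elem ((\<lambda>g. H #> g) ` C) = H <#> C" if "C \<in> carrier ?Q" for C
  proof -
    from that obtain s where s: "s \<in> S" and C: "C = (H \<inter> S) #> s"
      by (auto simp: FactGroup_def RCOSETS_def r_coset_def)
    have 1: "\<one> \<in> H \<inter> S"
      using subgrpS one_closed by (simp add: subgroup.one_closed)
    have sG: "s \<in> carrier G"
      using subgrpS s by (rule subgroup.mem_carrier)
    \<comment> \<open>Elements of \<open>C\<close> differ from \<open>s\<close> by a factor in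
      \<open>H\<close>, so they all determine one coset of \<open>H\<close>.\<close>
    have const: "H #> g = H #> s" if "g \<in> C" for g
    proof -
      from that obtain h where "h \<in> H" "g = h \<otimes> s"
        by (auto simp: C r_coset_def)
      then show ?thesis
        using sG by (metis coset_mult_assoc is_group mem_carrier rcos_const subset)
    qed
    have "C \<noteq> {}"
      using 1 unfolding C r_coset_def by blast
    with const have "(\<lambda>g. H #> g) ` C = {H #> s}"
      by blast
    then show ?thesis
      using 1 sG by (simp add: C set_mult_rcoset_absorb)
  qed
  have grp: "group ?Q"
    using normal_subgrp_intersection_normal by (simp add: Int_commute normal.factorgroup_is_group)
  show ?thesis
    using grp normal_intersection_quotient_isom by (rule group.iso_eq) (simp add: eq)
qed

end

text \<open>The same list of intervals serves for \<open>W\<close>: compose its isomorphisms with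
  \<open>\<psi>\<close> and paste the commuting squares.\<close>

lemma interval_decomposition_transfer:
  assumes V: "interval_decomposition V f J"
    and iso: "\<And>t. \<psi> t \<in> iso (V t) (W t)"
    and natural: "\<And>s t v. s \<le> t \<Longrightarrow> v \<in> carrier (V s) \<Longrightarrow> \<psi> t (f s t v) = h s t (\<psi> s v)"
  shows "interval_decomposition W h J"
proof -
  from V obtain ivs \<phi> where ivs: "mset ivs = J"
    and \<phi>: "\<And>t. \<phi> t \<in> iso (free_Z2_space (alive ivs t)) (V t)"
    and nat\<phi>: "\<And>s t c. s \<le> t \<Longrightarrow> c \<in> carrier (free_Z2_space (alive ivs s)) \<Longrightarrow>
      \<phi> t (restrict_chain (alive ivs t) c) = f s t (\<phi> s c)"
    unfolding interval_decomposition_def by blast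
  have "\<psi> t \<circ> \<phi> t \<in> iso (free_Z2_space (alive ivs t)) (W t)" for t
    using \<phi> iso by (rule iso_set_trans)
  moreover have "(\<psi> t \<circ> \<phi> t) (restrict_chain (alive ivs t) c) = h s t ((\<psi> s \<circ> \<phi> s) c)"
    if "s \<le> t" "c \<in> carrier (free_Z2_space (alive ivs s))" for s t c
  proof -
    have "\<phi> s c \<in> carrier (V s)"
      using \<phi>[of s] that(2) by (auto simp: iso_def hom_def)
    then show ?thesis
      using that by (simp add: nat\<phi> natural)
  qed
  ultimately show ?thesis
    using V ivs unfolding interval_decomposition_def
    by (intro conjI exI[of _ ivs] exI[of _ "\<lambda>t. \<psi> t \<circ> \<phi> t"]) auto
qed

text \<open>Equality of whole predicates lets the definite description in
  \<open>persistence_intervals\<close> be rewritten directly. For the converse direction the inverse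
  family is natural because \<open>f\<close> stays inside the carriers, where the inverse of
  \<open>\<psi> t\<close> cancels it.\<close>

lemma interval_decomposition_iso_eq:
  assumes group: "\<And>t. group (V t)"
    and closed: "\<And>s t v. s \<le> t \<Longrightarrow> v \<in> carrier (V s) \<Longrightarrow> f s t v \<in> carrier (V t)"
    and iso: "\<And>t. \<psi> t \<in> iso (V t) (W t)"
    and natural: "\<And>s t v. s \<le> t \<Longrightarrow> v \<in> carrier (V s) \<Longrightarrow> \<psi> t (f s t v) = h s t (\<psi> s v)"
  shows "interval_decomposition V f = interval_decomposition W h"
proof (intro ext iffI)
  fix J
  assume "interval_decomposition V f J"
  then show "interval_decomposition W h J"
    using iso natural by (rule interval_decomposition_transfer)
next
  fix J
  assume "interval_decomposition W h J"
  then show "interval_decomposition V f J"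
  proof (rule interval_decomposition_transfer)
    show "inv_into (carrier (V t)) (\<psi> t) \<in> iso (W t) (V t)" for t
      using group iso by (rule group.iso_set_sym)
  next
    fix s t w
    assume le: "s \<le> t" and w: "w \<in> carrier (W s)"
    have bij: "bij_betw (\<psi> t) (carrier (V t)) (carrier (W t))" for t
      using iso[of t] by (simp add: iso_def)
    then obtain v where v: "v \<in> carrier (V s)" "w = \<psi> s v"
      using w by (auto simp: bij_betw_def)
    have "inv_into (carrier (V t)) (\<psi> t) (h s t w) = f s t v"
      using v le closed bij[of t] by (simp add: natural[symmetric] bij_betw_inv_into_left)
    then show "inv_into (carrier (V t)) (\<psi> t) (h s t w) = f s t (inv_into (carrier (V s)) (\<psi> s) w)"
      using v bij[of s] by (simp add: bij_betw_inv_into_left)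
  qed
qed

section \<open>Chains and boundaries\<close>

lemma chain_add_self [simp]: "(c :: 'a \<Rightarrow>\<^sub>0 bit) + c = 0"
  by (rule poly_mapping_eqI) (simp add: lookup_add)

lemma comm_group_free_Z2_space: "comm_group (free_Z2_space S)"
proof (rule comm_groupI)
  show "\<exists>y\<in>carrier (free_Z2_space S). y \<otimes>\<^bsub>free_Z2_space S\<^esub> x = \<one>\<^bsub>free_Z2_space S\<^esub>"
    if "x \<in> carrier (free_Z2_space S)" for x
    using that by (intro bexI[of _ x]) (simp_all add: free_Z2_space_def)
qed (use Poly_Mapping.keys_add in \<open>fastforce simp: free_Z2_space_def ac_simps\<close>)+

lemma chain_inv [simp]: "inv\<^bsub>free_Z2_space UNIV\<^esub> c = c"
proof -
  interpret comm_group "free_Z2_space (UNIV :: 'a set)"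
    by (rule comm_group_free_Z2_space)
  show ?thesis
    by (rule inv_equality) (simp_all add: free_Z2_space_def)
qed

lemma subgroup_chains:
  assumes "0 \<in> H" "\<And>c d. c \<in> H \<Longrightarrow> d \<in> H \<Longrightarrow> c + d \<in> H"
  shows "subgroup H (free_Z2_space UNIV)"
proof
  show "H \<subseteq> carrier (free_Z2_space UNIV)"
    by (simp add: free_Z2_space_def)
  show "inv\<^bsub>free_Z2_space UNIV\<^esub> x \<in> H" if "x \<in> H" for x
    using that by simp
qed (use assms in \<open>simp_all add: free_Z2_space_def\<close>)

section \<open>Linearity of the boundary operator\<close>

lemma lookup_boundary:
  "Poly_Mapping.lookup (boundary X c) a = (\<Sum>x \<in> Poly_Mapping.keys c. Poly_Mapping.lookup (bd X x) a)"
  by (simp add: boundary_def lookup_sum)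

lemma boundary_0 [simp]: "boundary X 0 = 0"
  by (simp add: boundary_def)

lemma boundary_single [simp]: "boundary X (Poly_Mapping.single B 1) = bd X B"
  by (simp add: boundary_def)

lemma boundary_add: "boundary X (c + d) = boundary X c + boundary X d"
proof -
  let ?S = "Poly_Mapping.keys c \<union> Poly_Mapping.keys d"
  \<comment> \<open>The supports of \<open>c\<close>, \<open>d\<close> and \<open>c + d\<close>
    differ, so all three sums are taken over one common index set. Where both coefficients are 1,
    the terms cancel in characteristic 2.\<close>
  have eq: "boundary X e = (\<Sum>x \<in> ?S. if Poly_Mapping.lookup e x = 0 then 0 else bd X x)"
    if "Poly_Mapping.keys e \<subseteq> ?S" for e
    unfolding boundary_def using that
    by (intro sum.mono_neutral_cong_left) (auto simp: in_keys_iff)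
  show ?thesis
    using Poly_Mapping.keys_add[of c d]
    by (simp add: eq sum.distrib[symmetric] lookup_add)
       (auto intro!: sum.cong)
qed

lemma mem_chain_space:
  "c \<in> carrier (chain_space X p) \<longleftrightarrow> Poly_Mapping.keys c \<subseteq> {x \<in> cells X. cell_dim X x = p}"
  by (simp add: chain_space_def free_Z2_space_def)

lemma chain_space_add:
  "c \<in> carrier (chain_space X p) \<Longrightarrow> d \<in> carrier (chain_space X p) \<Longrightarrow> c + d \<in> carrier (chain_space X p)"
  using Poly_Mapping.keys_add[of c d] by (fastforce simp: mem_chain_space)

lemma boundary_in_chain_space:
  assumes "chain_complex X" "c \<in> carrier (chain_space X (p + 1))"
  shows "boundary X c \<in> carrier (chain_space X p)"
  using assms Poly_Mapping.keys_sum[of "bd X" "Poly_Mapping.keys c"]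
  by (fastforce simp: mem_chain_space boundary_def chain_complex_def)

lemma boundaries_subset_cycles:
  assumes "chain_complex X"
  shows "boundaries X p \<subseteq> cycles X p"
  using assms boundary_in_chain_space[OF assms]
  by (auto simp: boundaries_def cycles_def chain_complex_def)

lemma boundary_bd:
  assumes "chain_complex X" "B \<in> cells X"
  shows "boundary X (bd X B) = 0"
\<comment> \<open>\<open>chain_complex\<close> states \<partial>\<partial> = 0 on chains of positive
  dimension; a 0-cell has empty boundary.\<close>
proof (cases "cell_dim X B")
  case 0
  then have "Poly_Mapping.keys (bd X B) = {}"
    using assms by (force simp: chain_complex_def)
  then show ?thesis
    by (simp add: boundary_def)
next
  case (Suc p)
  then have "Poly_Mapping.single B 1 \<in> carrier (chain_space X (p + 1))"
    using assms by (simp add: mem_chain_space)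
  then have "boundary X (boundary X (Poly_Mapping.single B 1)) = 0"
    using assms unfolding chain_complex_def by blast
  then show ?thesis
    by simp
qed

section \<open>Homology groups as subquotients of one ambient group\<close>

lemma subgroup_cycles: "subgroup (cycles X p) (free_Z2_space UNIV)"
  by (rule subgroup_chains) (auto simp: cycles_def boundary_add chain_space_add, simp add: mem_chain_space)

lemma subgroup_boundaries: "subgroup (boundaries X p) (free_Z2_space UNIV)"
proof (rule subgroup_chains)
  show "0 \<in> boundaries X p"
    unfolding boundaries_def by (rule image_eqI[of _ _ 0]) (simp_all add: mem_chain_space)
next
  fix c d
  assume "c \<in> boundaries X p" "d \<in> boundaries X p"
  then show "c + d \<in> boundaries X p"
    unfolding boundaries_def by (auto simp: boundary_add[symmetric] intro: chain_space_add)
qed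

text \<open>Cosets depend only on addition, so the space of p-chains can be replaced by the space of
  all chains. Homology groups of different complexes then live in a single group, as the second
  isomorphism theorem requires.\<close>

lemma homology_eq:
  "homology X p = (free_Z2_space UNIV)\<lparr>carrier := cycles X p\<rparr> Mod boundaries X p"
  by (simp add: homology_def chain_space_def free_Z2_space_def)

lemma carrier_homology:
  "carrier (homology X p) = (\<lambda>z. boundaries X p #>\<^bsub>free_Z2_space UNIV\<^esub> z) ` cycles X p"
  by (auto simp: homology_eq FactGroup_def RCOSETS_def r_coset_def)

lemma homology_inclusion_eq:
  "homology_inclusion X Y p C = boundaries Y p <#>\<^bsub>free_Z2_space UNIV\<^esub> C"
  by (simp add: homology_inclusion_def chain_space_def free_Z2_space_def set_mult_def)

lemma group_homology:
  assumes "chain_complex X"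
  shows "group (homology X p)"
proof -
  interpret comm_group "free_Z2_space (UNIV :: 'a set)"
    by (rule comm_group_free_Z2_space)
  show ?thesis
    unfolding homology_eq
    by (intro normal.factorgroup_is_group normal_restrict_supergroup subgroup_cycles
        subgroup_imp_normal subgroup_boundaries boundaries_subset_cycles assms)
qed

lemma second_isomorphism_grp_homology:
  "second_isomorphism_grp (boundaries Y p) (free_Z2_space UNIV) (cycles X p)"
  by (simp add: second_isomorphism_grp_def second_isomorphism_grp_axioms_def subgroup_cycles
      comm_group.subgroup_imp_normal comm_group_free_Z2_space subgroup_boundaries)

lemma homology_inclusion_rcoset:
  assumes "boundaries X p \<subseteq> boundaries Y p"
  shows "homology_inclusion X Y p (boundaries X p #>\<^bsub>free_Z2_space UNIV\<^esub> z) =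
    boundaries Y p #>\<^bsub>free_Z2_space UNIV\<^esub> z"
  unfolding homology_inclusion_eq
  using second_isomorphism_grp_homology[of Y p X] assms
    subgroup.one_closed[OF subgroup_boundaries[of X p]]
  by (rule second_isomorphism_grp.set_mult_rcoset_absorb) (simp add: free_Z2_space_def)

section \<open>Subcomplexes\<close>

text \<open>Agreement of \<open>bd\<close> is asked only on the cells of \<open>X\<close>, because
  \<open>remove_cells\<close> truncates the boundary of \<open>A\<close>, which contains
  \<open>b\<close>.\<close>

definition subcomplex :: "'a cell_complex \<Rightarrow> 'a cell_complex \<Rightarrow> bool" where
  "subcomplex X Y \<longleftrightarrow> chain_complex Y \<and> cells X \<subseteq> cells Y \<and> cell_dim X = cell_dim Y \<and>
     (\<forall>B \<in> cells X. bd X B = bd Y B \<and> Poly_Mapping.keys (bd X B) \<subseteq> cells X)"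

lemma subcomplex_chain_space:
  "subcomplex X Y \<Longrightarrow> c \<in> carrier (chain_space X p) \<longleftrightarrow>
     c \<in> carrier (chain_space Y p) \<and> Poly_Mapping.keys c \<subseteq> cells X"
  by (auto simp: subcomplex_def mem_chain_space)

lemma subcomplex_boundary:
  "subcomplex X Y \<Longrightarrow> Poly_Mapping.keys c \<subseteq> cells X \<Longrightarrow> boundary X c = boundary Y c"
  unfolding boundary_def by (rule sum.cong) (auto simp: subcomplex_def)

lemma subcomplex_keys_boundary:
  "subcomplex X Y \<Longrightarrow> Poly_Mapping.keys c \<subseteq> cells X \<Longrightarrow> Poly_Mapping.keys (boundary Y c) \<subseteq> cells X"
  using Poly_Mapping.keys_sum[of "bd Y" "Poly_Mapping.keys c"]
  by (fastforce simp: subcomplex_def boundary_def)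

lemma subcomplex_chain_complex:
  assumes "subcomplex X Y"
  shows "chain_complex X"
  unfolding chain_complex_def
proof (intro conjI allI ballI)
  show "finite (cells X)"
    using assms by (auto simp: subcomplex_def chain_complex_def intro: finite_subset)
next
  fix B
  assume "B \<in> cells X"
  then show "Poly_Mapping.keys (bd X B) \<subseteq> {a \<in> cells X. cell_dim X a + 1 = cell_dim X B}"
    using assms by (fastforce simp: subcomplex_def chain_complex_def)
next
  fix p c
  assume c: "c \<in> carrier (chain_space X (p + 1))"
  with assms have "Poly_Mapping.keys c \<subseteq> cells X" "c \<in> carrier (chain_space Y (p + 1))"
    using subcomplex_chain_space by blast+
  then show "boundary X (boundary X c) = 0"
    using assms
    by (simp add: subcomplex_boundary subcomplex_keys_boundary)
       (auto simp: subcomplex_def chain_complex_def)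
qed

lemma subcomplex_sublevel:
  assumes X: "chain_complex X" and g: "filtering_function X g"
  shows "subcomplex (sublevel X g n) X"
proof -
  have "a \<in> cells X \<and> g a \<le> n"
    if "B \<in> cells X" "g B \<le> n" "a \<in> Poly_Mapping.keys (bd X B)" for a B
  proof -
    have "a \<in> cells X"
      using X that(1,3) unfolding chain_complex_def by blast
    moreover from this have "g a \<le> g B"
      using g that unfolding filtering_function_def by (simp add: is_face_def in_keys_iff)
    ultimately show ?thesis
      using that(2) by simp
  qed
  with X show ?thesis
    by (auto simp: subcomplex_def sublevel_def)
qed

text \<open>Inside a common complex \<open>Z\<close>, inclusion is a matter of cells alone; this
  supplies the inclusions between sublevel complexes.\<close>

lemma subcomplex_cell_subset:
  "subcomplex X Z \<Longrightarrow> subcomplex Y Z \<Longrightarrow> cells X \<subseteq> cells Y \<Longrightarrow> subcomplex X Y"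
  using subcomplex_chain_complex[of Y Z] by (simp add: subcomplex_def) (metis subsetD)

lemma subcomplex_trans:
  "subcomplex X Y \<Longrightarrow> subcomplex Y Z \<Longrightarrow> subcomplex X Z"
  unfolding subcomplex_def by (metis order_trans subsetD)

lemma filtering_function_subcomplex:
  "filtering_function Y g \<Longrightarrow> subcomplex X Y \<Longrightarrow> filtering_function X g"
  unfolding filtering_function_def is_face_def subcomplex_def by (metis subsetD)

lemma subcomplex_cycles:
  "subcomplex X Y \<Longrightarrow> cycles X p = {z \<in> cycles Y p. Poly_Mapping.keys z \<subseteq> cells X}"
  by (auto simp: cycles_def subcomplex_chain_space subcomplex_boundary)

lemma subcomplex_boundaries:
  assumes "subcomplex X Y"
  shows "boundaries X p \<subseteq> boundaries Y p"
  using assms by (auto simp: boundaries_def subcomplex_chain_space subcomplex_boundary)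

section \<open>Maps on homology induced by inclusions\<close>

lemma homology_inclusion_closed:
  assumes "subcomplex X Y" "C \<in> carrier (homology X p)"
  shows "homology_inclusion X Y p C \<in> carrier (homology Y p)"
  using assms
  by (auto simp: carrier_homology homology_inclusion_rcoset subcomplex_boundaries subcomplex_cycles)

lemma homology_inclusion_trans:
  assumes "subcomplex X Y" "subcomplex Y Z" "boundaries X p \<subseteq> boundaries Z p"
    and "C \<in> carrier (homology X p)"
  shows "homology_inclusion Y Z p (homology_inclusion X Y p C) = homology_inclusion X Z p C"
  using assms by (auto simp: carrier_homology homology_inclusion_rcoset subcomplex_boundaries)

text \<open>Write Z for cycles and B for boundaries. The two conditions give Z(Y) = B(Y) + Z(X)
  (surjectivity) and B(X) = B(Y) \<inter> Z(X) (injectivity), which turns the second isomorphism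
  theorem into the claim.\<close>

lemma homology_inclusion_iso:
  assumes sub: "subcomplex X Y"
    and cycles: "\<And>z. z \<in> cycles Y p \<Longrightarrow> \<exists>h \<in> boundaries Y p. z + h \<in> cycles X p"
    and boundaries: "boundaries Y p \<inter> cycles X p \<subseteq> boundaries X p"
  shows "homology_inclusion X Y p \<in> iso (homology X p) (homology Y p)"
proof -
  have Y: "chain_complex Y"
    using sub by (simp add: subcomplex_def)
  have "cycles Y p = boundaries Y p <#>\<^bsub>free_Z2_space UNIV\<^esub> cycles X p"
  proof
    show "cycles Y p \<subseteq> boundaries Y p <#>\<^bsub>free_Z2_space UNIV\<^esub> cycles X p"
    proof
      fix z
      assume "z \<in> cycles Y p"
      then obtain h where "h \<in> boundaries Y p" "z + h \<in> cycles X p"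
        using cycles by blast
      then have "h + (z + h) \<in> boundaries Y p <#>\<^bsub>free_Z2_space UNIV\<^esub> cycles X p"
        unfolding set_mult_def by (intro UN_I[of h] UN_I[of "z + h"]) (simp_all add: free_Z2_space_def)
      moreover have "h + (z + h) = z"
        by (metis add.assoc add.commute add.right_neutral chain_add_self)
      ultimately show "z \<in> boundaries Y p <#>\<^bsub>free_Z2_space UNIV\<^esub> cycles X p"
        by simp
    qed
    have "h + z \<in> cycles Y p" if "h \<in> boundaries Y p" "z \<in> cycles X p" for h z
      using that boundaries_subset_cycles[OF Y, of p] subcomplex_cycles[OF sub, of p]
        subgroup.m_closed[OF subgroup_cycles, of h Y p z]
      by (auto simp: free_Z2_space_def)
    then show "boundaries Y p <#>\<^bsub>free_Z2_space UNIV\<^esub> cycles X p \<subseteq> cycles Y p"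
      by (auto simp: set_mult_def free_Z2_space_def)
  qed
  moreover have "boundaries X p = boundaries Y p \<inter> cycles X p"
    using boundaries subcomplex_boundaries[OF sub]
      boundaries_subset_cycles[OF subcomplex_chain_complex[OF sub]]
    by blast
  moreover have "homology_inclusion X Y p = (\<lambda>C. boundaries Y p <#>\<^bsub>free_Z2_space UNIV\<^esub> C)"
    by (simp add: fun_eq_iff homology_inclusion_eq)
  ultimately show ?thesis
    using second_isomorphism_grp.normal_intersection_set_mult_iso
      [OF second_isomorphism_grp_homology[of Y p X]]
    by (simp add: homology_eq)
qed

section \<open>Collapses\<close>

text \<open>A nonzero coefficient in \<open>bit\<close> is 1, so a unique coface prescribes every
  coefficient of \<open>b\<close>. This form can be summed over a chain and passes at once to
  sublevel complexes containing both cells.\<close>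

lemma elementary_collapse_pair_iff:
  "elementary_collapse_pair X A b \<longleftrightarrow> A \<in> cells X \<and> b \<in> cells X \<and>
     (\<forall>B \<in> cells X. Poly_Mapping.lookup (bd X B) b = of_bool (B = A))"
proof -
  have "elementary_collapse_pair X A b \<longleftrightarrow> is_face X b A \<and> (\<forall>B. is_face X b B \<longrightarrow> B = A)"
    unfolding elementary_collapse_pair_def free_face_def is_face_def by blast
  also have "\<dots> \<longleftrightarrow> A \<in> cells X \<and> b \<in> cells X \<and>
      (\<forall>B \<in> cells X. Poly_Mapping.lookup (bd X B) b \<noteq> 0 \<longleftrightarrow> B = A)"
    unfolding is_face_def by blast
  also have "(\<lambda>B. Poly_Mapping.lookup (bd X B) b \<noteq> 0 \<longleftrightarrow> B = A) =
      (\<lambda>B. Poly_Mapping.lookup (bd X B) b = of_bool (B = A))"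
    by (simp add: fun_eq_iff of_bool_def)
  finally show ?thesis .
qed

lemma lookup_boundary_collapse:
  assumes "elementary_collapse_pair X A b" "Poly_Mapping.keys c \<subseteq> cells X"
  shows "Poly_Mapping.lookup (boundary X c) b = Poly_Mapping.lookup c A"
proof -
  have "Poly_Mapping.lookup (bd X x) b = (if x = A then 1 else 0)" if "x \<in> Poly_Mapping.keys c" for x
    using assms that by (auto simp: elementary_collapse_pair_iff)
  then have "Poly_Mapping.lookup (boundary X c) b = (\<Sum>x \<in> Poly_Mapping.keys c. if x = A then 1 else 0)"
    by (simp add: lookup_boundary)
  also have "\<dots> = Poly_Mapping.lookup c A"
    by (simp add: sum.delta in_keys_iff)
  finally show ?thesis .
qed

text \<open>Apply the previous lemma to the chain \<open>bd X B\<close>, whose boundary is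
  0.\<close>

lemma collapse_no_coface:
  assumes "chain_complex X" "elementary_collapse_pair X A b" "B \<in> cells X"
  shows "Poly_Mapping.lookup (bd X B) A = 0"
proof -
  have "Poly_Mapping.keys (bd X B) \<subseteq> cells X"
    using assms by (auto simp: chain_complex_def)
  from lookup_boundary_collapse[OF assms(2) this] show ?thesis
    using assms by (simp add: boundary_bd)
qed

text \<open>\<open>A\<close> is excluded because it has no coface, \<open>b\<close> because its only
  coface \<open>A\<close> is not \<open>B\<close>. Hence deleting the pair cuts nothing from the
  remaining boundaries.\<close>

lemma collapse_keys_bd:
  assumes "chain_complex X" "elementary_collapse_pair X A b" "B \<in> cells X - {A, b}"
  shows "Poly_Mapping.keys (bd X B) \<subseteq> cells X - {A, b}"
proof -
  have "Poly_Mapping.keys (bd X B) \<subseteq> cells X"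
    using assms by (auto simp: chain_complex_def)
  moreover have "A \<notin> Poly_Mapping.keys (bd X B)"
    using assms by (simp add: in_keys_iff collapse_no_coface[OF assms(1,2)])
  moreover have "b \<notin> Poly_Mapping.keys (bd X B)"
    using assms(2,3) by (auto simp: elementary_collapse_pair_iff in_keys_iff)
  ultimately show ?thesis
    by auto
qed

lemma collapse_dim:
  assumes "chain_complex X" "elementary_collapse_pair X A b"
  shows "cell_dim X A = cell_dim X b + 1"
proof -
  have "A \<in> cells X" "b \<in> Poly_Mapping.keys (bd X A)"
    using assms(2) by (auto simp: elementary_collapse_pair_iff in_keys_iff)
  then have "b \<in> {a \<in> cells X. cell_dim X a + 1 = cell_dim X A}"
    using assms(1) unfolding chain_complex_def by blast
  then show ?thesis
    by simp
qed

text \<open>Adding \<open>\<partial>A\<close>, in which \<open>b\<close> occurs and \<open>A\<close> does not, removes \<open>b\<close> from a chain without changing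
  its boundary.\<close>

lemma collapse_chain_reduction:
  assumes X: "chain_complex X" and pair: "elementary_collapse_pair X A b"
    and c: "c \<in> carrier (chain_space X p)" and A: "Poly_Mapping.lookup c A = 0"
  obtains h where "h \<in> boundaries X p" "boundary X h = 0" "c + h \<in> carrier (chain_space X p)"
    "Poly_Mapping.keys (c + h) \<subseteq> cells X - {A, b}"
proof (cases "Poly_Mapping.lookup c b = 0")
  case True
  show thesis
  proof
    show "0 \<in> boundaries X p"
      using subgroup.one_closed[OF subgroup_boundaries[of X p]] by (simp add: free_Z2_space_def)
  qed (use c A True in \<open>auto simp: mem_chain_space in_keys_iff\<close>)
next
  case False
  have cells: "A \<in> cells X" "b \<in> cells X" "Poly_Mapping.lookup (bd X A) b = 1"
    using pair by (auto simp: elementary_collapse_pair_iff)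
  \<comment> \<open>As \<open>b\<close> occurs in the p-chain \<open>c\<close>, its coface
    \<open>A\<close> has dimension \<open>p + 1\<close>, so \<partial>A is a boundary in degree
    \<open>p\<close> and can serve as \<open>h\<close>.\<close>
  have "cell_dim X b = p"
    using False c unfolding mem_chain_space by (metis (mono_tags, lifting) in_keys_iff mem_Collect_eq subsetD)
  then have single: "Poly_Mapping.single A 1 \<in> carrier (chain_space X (p + 1))"
    using cells X pair by (simp add: mem_chain_space collapse_dim)
  show thesis
  proof
    show bdA: "bd X A \<in> boundaries X p"
      unfolding boundaries_def using single by (rule rev_image_eqI) simp
    show "boundary X (bd X A) = 0"
      using X cells by (simp add: boundary_bd)
    have "bd X A \<in> carrier (chain_space X p)"
      using bdA boundaries_subset_cycles[OF X] by (auto simp: cycles_def)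
    with c show sum: "c + bd X A \<in> carrier (chain_space X p)"
      by (rule chain_space_add)
    have "Poly_Mapping.lookup (c + bd X A) A = 0" "Poly_Mapping.lookup (c + bd X A) b = 0"
      using A False cells collapse_no_coface[OF X pair] by (simp_all add: lookup_add)
    with sum show "Poly_Mapping.keys (c + bd X A) \<subseteq> cells X - {A, b}"
      by (auto simp: mem_chain_space in_keys_iff)
  qed
qed

text \<open>\<open>X\<close> is described by its cells and not as
  \<open>remove_cells Y {A, b}\<close>: taking a sublevel and deleting the pair, in either order,
  gives the same cells, but the two values of \<open>bd\<close> may differ off these cells.\<close>

lemma collapse_homology_iso:
  assumes pair: "elementary_collapse_pair Y A b"
    and sub: "subcomplex X Y" and cells: "cells X = cells Y - {A, b}"
  shows "homology_inclusion X Y p \<in> iso (homology X p) (homology Y p)"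
  using sub
proof (rule homology_inclusion_iso)
  have Y: "chain_complex Y"
    using sub by (simp add: subcomplex_def)
  {
    fix z
    assume "z \<in> cycles Y p"
    then have chain: "z \<in> carrier (chain_space Y p)" and z0: "boundary Y z = 0"
      by (simp_all add: cycles_def)
    have "Poly_Mapping.keys z \<subseteq> cells Y"
      using chain by (auto simp: mem_chain_space)
    \<comment> \<open>The coefficient of \<open>A\<close> in \<open>z\<close> is that of
      \<open>b\<close> in \<partial>z = 0.\<close>
    then have "Poly_Mapping.lookup z A = 0"
      using lookup_boundary_collapse[OF pair, of z] z0 by simp
    then obtain h where h: "h \<in> boundaries Y p" "boundary Y h = 0"
      "z + h \<in> carrier (chain_space Y p)" "Poly_Mapping.keys (z + h) \<subseteq> cells Y - {A, b}"
      using collapse_chain_reduction[OF Y pair chain] by blast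
    then have "z + h \<in> cycles X p"
      using z0 by (simp add: subcomplex_cycles[OF sub] cells) (simp add: cycles_def boundary_add)
    with h show "\<exists>h \<in> boundaries Y p. z + h \<in> cycles X p"
      by blast
  }
  show "boundaries Y p \<inter> cycles X p \<subseteq> boundaries X p"
  proof
    fix z
    assume z: "z \<in> boundaries Y p \<inter> cycles X p"
    then obtain c where c: "c \<in> carrier (chain_space Y (p + 1))" and zc: "z = boundary Y c"
      by (auto simp: boundaries_def)
    have "Poly_Mapping.keys z \<subseteq> cells Y - {A, b}"
      using z by (simp add: subcomplex_cycles[OF sub] cells)
    then have "Poly_Mapping.lookup z b = 0"
      by (auto simp: in_keys_iff)
    moreover have "Poly_Mapping.keys c \<subseteq> cells Y"
      using c by (auto simp: mem_chain_space)
    \<comment> \<open>Here the coefficient of \<open>A\<close> in \<open>c\<close> is that of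
      \<open>b\<close> in \<open>z\<close>, and \<open>z\<close> avoids \<open>b\<close>. Reducing
      \<open>c\<close> keeps its boundary \<open>z\<close> and moves it into
      \<open>X\<close>.\<close>
    ultimately have "Poly_Mapping.lookup c A = 0"
      using lookup_boundary_collapse[OF pair, of c] zc by simp
    then obtain h where h: "boundary Y h = 0"
      "c + h \<in> carrier (chain_space Y (p + 1))" "Poly_Mapping.keys (c + h) \<subseteq> cells X"
      using collapse_chain_reduction[OF Y pair c] cells by metis
    have "boundary X (c + h) = z"
      using h zc subcomplex_boundary[OF sub, of "c + h"] by (simp add: boundary_add)
    moreover have "c + h \<in> carrier (chain_space X (p + 1))"
      using h by (simp add: subcomplex_chain_space[OF sub])
    ultimately show "z \<in> boundaries X p"
      unfolding boundaries_def by blast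
  qed
qed

section \<open>Deleting the pair from a filtered complex\<close>

lemma restrict_chain_id:
  assumes "Poly_Mapping.keys c \<subseteq> S"
  shows "restrict_chain S c = c"
proof (rule poly_mapping_eqI)
  fix k
  have "Poly_Mapping.lookup (restrict_chain S c) k =
      (\<Sum>x \<in> Poly_Mapping.keys c. if x = k then Poly_Mapping.lookup c k else 0)"
    using assms unfolding restrict_chain_def lookup_sum
    by (intro sum.cong) (auto simp: lookup_single)
  also have "\<dots> = Poly_Mapping.lookup c k"
    by (simp add: in_keys_iff)
  finally show "Poly_Mapping.lookup (restrict_chain S c) k = Poly_Mapping.lookup c k" .
qed

lemma subcomplex_remove_collapse:
  assumes "chain_complex X" "elementary_collapse_pair X A b"
  shows "subcomplex (remove_cells X {A, b}) X"
  using assms collapse_keys_bd[OF assms]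
  by (simp add: subcomplex_def remove_cells_def restrict_chain_id)

theorem theorem3p1:
  fixes K :: "'a cell_complex" and g :: "'a \<Rightarrow> int" and A b :: 'a
  assumes "chain_complex K"
    and "filtering_function K g"
    and "elementary_collapse_pair K A b"
    and "\<And>n. b \<in> cells (sublevel K g n) \<Longrightarrow> free_face (sublevel K g n) b"
    and "g A = g b"
  shows "\<forall>p. same_persistent_homology K g (remove_cells K {A, b}) g p"
proof
  fix p
  let ?K = "sublevel K g" and ?L = "sublevel (remove_cells K {A, b}) g"
  let ?V = "\<lambda>t. homology (?L t) p" and ?f = "\<lambda>s t. homology_inclusion (?L s) (?L t) p"
  let ?W = "\<lambda>t. homology (?K t) p" and ?h = "\<lambda>s t. homology_inclusion (?K s) (?K t) p"
  have sub: "subcomplex (remove_cells K {A, b}) K"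
    using assms by (simp add: subcomplex_remove_collapse)
  have subK: "subcomplex (?K t) K" for t
    using assms by (simp add: subcomplex_sublevel)
  have subL: "subcomplex (?L t) (remove_cells K {A, b})" for t
    using subcomplex_chain_complex[OF sub] filtering_function_subcomplex[OF assms(2) sub]
    by (rule subcomplex_sublevel)
  have KK: "subcomplex (?K s) (?K t)" if "s \<le> t" for s t
    using subK subK by (rule subcomplex_cell_subset) (use that in \<open>auto simp: sublevel_def\<close>)
  have LL: "subcomplex (?L s) (?L t)" if "s \<le> t" for s t
    using subL subL by (rule subcomplex_cell_subset) (use that in \<open>auto simp: sublevel_def\<close>)
  have cells: "cells (?L t) = cells (?K t) - {A, b}" for t
    by (auto simp: sublevel_def remove_cells_def)
  have LK: "subcomplex (?L t) (?K t)" for t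
    using subcomplex_trans[OF subL sub] subK
    by (rule subcomplex_cell_subset) (simp add: cells)
  have "interval_decomposition ?V ?f = interval_decomposition ?W ?h"
  proof (rule interval_decomposition_iso_eq)
    show "group (?V t)" for t
      by (rule group_homology, rule subcomplex_chain_complex, rule LK)
    show "?f s t v \<in> carrier (?V t)" if "s \<le> t" "v \<in> carrier (?V s)" for s t v
      using LL[OF that(1)] that(2) by (rule homology_inclusion_closed)
    show "homology_inclusion (?L t) (?K t) p \<in> iso (?V t) (?W t)" for t
    \<comment> \<open>Since \<open>g A = g b\<close>, both cells of the pair enter the filtration at
      the same index: either both are present at \<open>t\<close> or neither is.\<close>
    proof (cases "g b \<le> t")
      case True
      then have "elementary_collapse_pair (?K t) A b"
        using assms(3,5) by (auto simp: elementary_collapse_pair_iff sublevel_def)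
      then show ?thesis
        using LK cells by (rule collapse_homology_iso)
    next
      case False
      then have "cells (?L t) = cells (?K t)"
        using assms(5) by (auto simp: cells) (auto simp: sublevel_def)
      \<comment> \<open>With equal cells each complex is a subcomplex of the other, so cycles and
        boundaries agree and the correction term in \<open>homology_inclusion_iso\<close> is
        0.\<close>
      then have "subcomplex (?K t) (?L t)"
        using subcomplex_cell_subset[OF subK subcomplex_trans[OF subL sub]] by simp
      then have "boundaries (?L t) p = boundaries (?K t) p" "cycles (?L t) p = cycles (?K t) p"
        using subcomplex_boundaries subcomplex_cycles LK[of t] by blast+
      moreover have "0 \<in> boundaries (?K t) p"
        using subgroup.one_closed[OF subgroup_boundaries[of "?K t" p]] by (simp add: free_Z2_space_def)
      ultimately show ?thesis
        using LK by (intro homology_inclusion_iso) auto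
    qed
    \<comment> \<open>Both ways round the square are the map induced by the inclusion of
      \<open>?L s\<close> in \<open>?K t\<close>.\<close>
    show "homology_inclusion (?L t) (?K t) p (?f s t v) = ?h s t (homology_inclusion (?L s) (?K s) p v)"
      if "s \<le> t" "v \<in> carrier (?V s)" for s t v
    proof -
      have "boundaries (?L s) p \<subseteq> boundaries (?K t) p"
        using subcomplex_boundaries[OF LL] subcomplex_boundaries[OF LK] that(1) by blast
      then show ?thesis
        using that LL KK LK by (simp add: homology_inclusion_trans)
    qed
  qed
  then show "same_persistent_homology K g (remove_cells K {A, b}) g p"
    by (simp add: same_persistent_homology_def persistence_intervals_def)
qed

end
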